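(* Let $\mathcal{R}_i^{(2)}$, $i\ge 1$, be the length of the $i$-th zero run of the sequence $T_n \bmod 2$, where $T_n=\frac{1}{n+1}\binom{3n+1}{n}$ for $n\ge 0$. For $i\ge 1$, the entry $\mathcal{R}_i^{(2)}$ is a left-to-right maximum of the sequence $\langle \mathcal{R}_i^{(2)}\rangle_{i\ge1}$ if and only if $i=\mathcal{F}_k$ for some $k\ge 2$. Moreover, for every $k\ge 2$, $$\mathcal{R}_{\mathcal{F}_k}^{(2)}=\mathcal{J}_{k-1}.$$
   Context: For a prime $p$, a zero run of $T_n\bmod p$ is a maximal (nonempty) interval of consecutive indices $n\ge 0$ on which $T_n\equiv 0\pmod p$. Zero runs are numbered from left to right starting with $1$, and $\mathcal{R}_i^{(p)}$ denotes the length (number of indices) of the $i$-th zero run. For a sequence $\langle a_i\rangle_{i\ge1}$, the entry $a_k$ is a left-to-right maximum (record) if $a_k\ge a_i$ for every $i<k$ (ties are allowed). Fibonacci numbers: $\mathcal{F}_0=0$, $\mathcal{F}_1=1$, $\mathcal{F}_{n+1}=\mathcal{F}_n+\mathcal{F}_{n-1}$. Jacobsthal numbers: $\mathcal{J}_0=0$, $\mathcal{J}_1=1$, $\mathcal{J}_{n+1}=\mathcal{J}_n+2\mathcal{J}_{n-1}$. *)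

theory Defs
  imports Complex_Main "HOL-Number_Theory.Fib"
begin

text \<open>The division is exact, see \<open>Suc_dvd_choose\<close> and \<open>real_T_seq\<close> below.\<close>

definition T_seq :: "nat \<Rightarrow> nat" where
  "T_seq n = ((3 * n + 1) choose n) div (n + 1)"

lemma Suc_dvd_choose: "(n + 1) dvd ((3 * n + 1) choose n)"
proof -
  have "(n + 1) * ((3 * n + 1) choose (n + 1)) = (2 * n + 1) * ((3 * n + 1) choose n)"
    using binomial_absorb_comp[of "3 * n + 1" n] binomial_absorption[of n "3 * n + 1"]
    by (simp add: algebra_simps)
  then have "(n + 1) dvd (2 * n + 1) * ((3 * n + 1) choose n)"
    by (metis dvd_triv_left)
  moreover have "coprime (n + 1) (2 * n + 1)"
  proof (rule coprimeI)
    fix d assume d: "d dvd n + 1" "d dvd 2 * n + 1"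
    then have "d dvd 2 * (n + 1) - (2 * n + 1)"
      by (intro dvd_diff_nat dvd_mult)
    then show "is_unit d" by simp
  qed
  ultimately show ?thesis
    by (simp only: coprime_dvd_mult_right_iff)
qed

lemma real_T_seq: "real (T_seq n) = 1 / (real n + 1) * real ((3 * n + 1) choose n)"
  unfolding T_seq_def using real_of_nat_div[OF Suc_dvd_choose, of n] by simp

definition nat_interval :: "nat set \<Rightarrow> bool" where
  "nat_interval I \<longleftrightarrow> (\<forall>a\<in>I. \<forall>b\<in>I. \<forall>c. a \<le> c \<and> c \<le> b \<longrightarrow> c \<in> I)"

definition zero_interval :: "nat \<Rightarrow> nat set \<Rightarrow> bool" where
  "zero_interval p I \<longleftrightarrow> I \<noteq> {} \<and> nat_interval I \<and> (\<forall>n\<in>I. T_seq n mod p = 0)"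

definition zero_run :: "nat \<Rightarrow> nat set \<Rightarrow> bool" where
  "zero_run p I \<longleftrightarrow> zero_interval p I \<and> (\<forall>J. zero_interval p J \<and> I \<subseteq> J \<longrightarrow> J = I)"

text \<open>Runs are numbered from the left, starting with 1: the \<open>i\<close>-th run has exactly \<open>i - 1\<close>
  runs entirely to its left (distinct runs are disjoint intervals).\<close>

definition nth_zero_run :: "nat \<Rightarrow> nat \<Rightarrow> nat set \<Rightarrow> bool" where
  "nth_zero_run p i I \<longleftrightarrow>
     zero_run p I \<and> card {J. zero_run p J \<and> (\<forall>m\<in>J. \<forall>n\<in>I. m < n)} + 1 = i"

definition run_length :: "nat \<Rightarrow> nat \<Rightarrow> nat" where
  "run_length p i = card (THE I. nth_zero_run p i I)"

text \<open>Sequences are indexed from 1; their value at 0 is irrelevant. Ties are allowed.\<close>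

definition left_to_right_max :: "(nat \<Rightarrow> nat) \<Rightarrow> nat \<Rightarrow> bool" where
  "left_to_right_max a k \<longleftrightarrow> (\<forall>i. 1 \<le> i \<and> i < k \<longrightarrow> a i \<le> a k)"

fun jacobsthal :: "nat \<Rightarrow> nat" where
  "jacobsthal 0 = 0"
| "jacobsthal (Suc 0) = 1"
| "jacobsthal (Suc (Suc n)) = jacobsthal (Suc n) + 2 * jacobsthal n"

end

theory Submission
  imports Defs "HOL-Library.Infinite_Set"
begin

text \<open>
  Since \<open>(2n + 1) T\<^sub>n = (3n + 1 choose n + 1)\<close>, Lucas' theorem modulo 2 shows that \<open>T\<^sub>n\<close> is odd iff
  \<open>n = 2m\<close> where \<open>m\<close> has no two adjacent ones in binary. Let \<open>f 0 < f 1 < \<dots>\<close> enumerate these \<open>m\<close>.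
  The \<open>i\<close>-th zero run is the open interval from \<open>2 f (i - 1)\<close> to \<open>2 f i\<close>. There are
  \<open>F (K + 2)\<close> such numbers below \<open>2 ^ K\<close>, and those in the upper half of the range below
  \<open>2 ^ (K + 2)\<close> are a translate of those below \<open>2 ^ K\<close>. Hence the gaps of \<open>f\<close> strictly between two
  Fibonacci indices repeat an initial part of the gap sequence, and a new record appears exactly
  when a power of two is reached.
\<close>

section \<open>Binomial coefficients modulo 2\<close>

lemma even_choose_even_odd: "even ((2 * a) choose (2 * b + 1))"
proof -
  have "(2 * b + 1) * ((2 * a) choose (2 * b + 1)) = 2 * a * ((2 * a - 1) choose (2 * b))"
    using binomial_absorption[of "2 * b" "2 * a"] by simp
  then have "even ((2 * b + 1) * ((2 * a) choose (2 * b + 1)))"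
    by simp
  then show ?thesis by simp
qed

text \<open>Two applications of Pascal's rule in row \<open>2 * a\<close> double the middle term, so
  modulo 2 they act as a single application in row \<open>a\<close>.\<close>

lemma odd_choose_even_even: "odd ((2 * a) choose (2 * b)) \<longleftrightarrow> odd (a choose b)"
proof (induction a arbitrary: b)
  case 0
  then show ?case by (cases b) auto
next
  case (Suc a)
  show ?case
  proof (cases b)
    case 0
    then show ?thesis by simp
  next
    case (Suc c)
    have "(2 * Suc a) choose (2 * b) = ((2 * a) choose (2 * c)) + 2 * ((2 * a) choose (2 * c + 1))
        + ((2 * a) choose (2 * Suc c))"
      using Suc by simp
    then have "odd ((2 * Suc a) choose (2 * b)) \<longleftrightarrow>
        odd (((2 * a) choose (2 * c)) + ((2 * a) choose (2 * Suc c)))"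
      by simp
    also have "\<dots> \<longleftrightarrow> odd ((a choose c) + (a choose Suc c))"
      unfolding even_add using Suc.IH[of c] Suc.IH[of "Suc c"] by blast
    finally show ?thesis using Suc by simp
  qed
qed

lemma odd_choose_odd_odd: "odd ((2 * a + 1) choose (2 * b + 1)) \<longleftrightarrow> odd (a choose b)"
  using odd_choose_even_even[of a b] even_choose_even_odd[of a b] by simp

lemma odd_choose_odd_even: "odd ((2 * a + 1) choose (2 * b)) \<longleftrightarrow> odd (a choose b)"
proof (cases b)
  case (Suc c)
  then show ?thesis
    using odd_choose_even_even[of a b] even_choose_even_odd[of a c] by simp
qed simp

section \<open>Parity of \<open>T_seq\<close>\<close>

lemma odd_T_seq_iff_odd_choose: "odd (T_seq n) \<longleftrightarrow> odd ((3 * n + 1) choose (n + 1))"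
proof -
  have "(n + 1) * ((3 * n + 1) choose (n + 1)) = (2 * n + 1) * ((3 * n + 1) choose n)"
    using binomial_absorb_comp[of "3 * n + 1" n] binomial_absorption[of n "3 * n + 1"]
    by (simp add: algebra_simps)
  also have "(3 * n + 1) choose n = (n + 1) * T_seq n"
    unfolding T_seq_def using Suc_dvd_choose[of n] by (metis dvd_mult_div_cancel)
  finally have "(n + 1) * ((3 * n + 1) choose (n + 1)) = (n + 1) * ((2 * n + 1) * T_seq n)"
    by (simp only: mult.left_commute)
  then have "(3 * n + 1) choose (n + 1) = (2 * n + 1) * T_seq n"
    by (subst (asm) mult_left_cancel) auto
  then show ?thesis by simp
qed

text \<open>Settles odd indices of \<open>T_seq\<close>. Comparing last binary digits gives an
  even-over-odd coefficient for even \<open>m\<close>, and for \<open>m = 2 * k + 1\<close> the same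
  coefficient with \<open>k\<close> in place of \<open>m\<close>.\<close>

lemma even_choose_3n2: "even ((3 * m + 2) choose (m + 1))"
proof (induction m rule: less_induct)
  case (less m)
  show ?case
  proof (cases "even m")
    case True
    then obtain k where "m = 2 * k" by blast
    then show ?thesis using even_choose_even_odd[of "3 * k + 1" k] by (simp add: algebra_simps)
  next
    case False
    then obtain k where k: "m = 2 * k + 1" by (elim oddE)
    have "3 * m + 2 = 2 * (3 * k + 2) + 1" "m + 1 = 2 * (k + 1)" using k by auto
    then have "odd ((3 * m + 2) choose (m + 1)) \<longleftrightarrow> odd ((3 * k + 2) choose (k + 1))"
      by (simp only: odd_choose_odd_even)
    then show ?thesis using less[of k] k by auto
  qed
qed

text \<open>By Lucas' theorem modulo 2, \<open>3m choose m\<close> is odd iff adding \<open>m\<close> and \<open>2m\<close> in binary produces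
  no carry, i.e. iff no two adjacent binary digits of \<open>m\<close> are both 1.\<close>

definition fibbinary :: "nat \<Rightarrow> bool" where
  "fibbinary m \<longleftrightarrow> odd ((3 * m) choose m)"

lemma odd_T_seq_iff: "odd (T_seq n) \<longleftrightarrow> (\<exists>m. n = 2 * m \<and> fibbinary m)"
proof (cases "even n")
  case True
  then obtain m where m: "n = 2 * m" by blast
  then have "3 * n + 1 = 2 * (3 * m) + 1" by simp
  then show ?thesis
    unfolding odd_T_seq_iff_odd_choose fibbinary_def
    using m odd_choose_odd_odd[of "3 * m" m] by auto
next
  case False
  then obtain m where m: "n = 2 * m + 1" by (elim oddE)
  have "3 * n + 1 = 2 * (3 * m + 2)" "n + 1 = 2 * (m + 1)" using m by auto
  then have "odd (T_seq n) \<longleftrightarrow> odd ((3 * m + 2) choose (m + 1))"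
    by (simp only: odd_T_seq_iff_odd_choose odd_choose_even_even)
  moreover have "n \<noteq> 2 * k" for k using m by presburger
  ultimately show ?thesis using even_choose_3n2[of m] by blast
qed

section \<open>Binary digits of fibbinary numbers\<close>

lemma fibbinary_0: "fibbinary 0"
  by (simp add: fibbinary_def)

lemma fibbinary_double: "fibbinary (2 * k) \<longleftrightarrow> fibbinary k"
  using odd_choose_even_even[of "3 * k" k] by (simp add: fibbinary_def)

lemma fibbinary_4k1: "fibbinary (4 * k + 1) \<longleftrightarrow> fibbinary k"
proof -
  have "3 * (4 * k + 1) = 2 * (2 * (3 * k) + 1) + 1" "4 * k + 1 = 2 * (2 * k) + 1" by auto
  then show ?thesis
    by (simp only: fibbinary_def odd_choose_odd_odd odd_choose_odd_even)
qed

lemma not_fibbinary_4k3: "\<not> fibbinary (4 * k + 3)"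
proof -
  have "3 * (4 * k + 3) = 2 * (2 * (3 * k + 2)) + 1" "4 * k + 3 = 2 * (2 * k + 1) + 1" by auto
  then have "fibbinary (4 * k + 3) \<longleftrightarrow> odd ((2 * (3 * k + 2)) choose (2 * k + 1))"
    by (simp only: fibbinary_def odd_choose_odd_odd)
  then show ?thesis using even_choose_even_odd by blast
qed

lemma fibbinary_1: "fibbinary 1"
  using fibbinary_4k1[of 0] fibbinary_0 by simp

lemma fibbinary_power2: "fibbinary (2 ^ K)"
  by (induction K) (auto simp: fibbinary_double fibbinary_1[simplified])

text \<open>A leading one at position \<open>K + 1\<close> conflicts only with a one at position
  \<open>K\<close>. The induction strips low-order digits, since the recursion of
  \<open>fibbinary\<close> acts there.\<close>

lemma fibbinary_power2_add:
  assumes "x < 2 ^ Suc K"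
  shows "fibbinary (2 ^ Suc K + x) \<longleftrightarrow> x < 2 ^ K \<and> fibbinary x"
  using assms
proof (induction K arbitrary: x rule: less_induct)
  case (less K)
  have "even x \<or> x mod 4 = 1 \<or> x mod 4 = 3" by presburger
  then consider (dbl) y where "x = 2 * y"
    | (one) y where "x = 4 * y + 1" | (three) y where "x = 4 * y + 3"
    by (metis evenE mult_div_mod_eq)
  then show ?case
  proof cases
    case dbl
    show ?thesis
    proof (cases K)
      case 0
      then have "y = 0" using dbl less.prems by simp
      then show ?thesis using 0 dbl fibbinary_0 fibbinary_power2[of 1] by simp
    next
      case (Suc L)
      have "2 ^ Suc K + x = 2 * (2 ^ Suc L + y)" using dbl Suc by simp
      then have "fibbinary (2 ^ Suc K + x) \<longleftrightarrow> fibbinary (2 ^ Suc L + y)"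
        by (simp only: fibbinary_double)
      then show ?thesis
        using less.IH[of L y] less.prems dbl Suc by (simp add: fibbinary_double)
    qed
  next
    case one
    \<comment> \<open>Stripping the digits 01 lowers the exponent by two, so the sums 3 and 5
      arising for \<open>K = 0\<close> and \<open>K = 1\<close> are checked directly.\<close>
    consider "K = 0" | "K = 1" | L where "K = Suc (Suc L)"
      by (metis One_nat_def not0_implies_Suc)
    then show ?thesis
    proof cases
      case 1
      then show ?thesis using one less.prems not_fibbinary_4k3[of 0] by (simp add: numeral_eq_Suc)
    next
      case 2
      then have "y = 0" using one less.prems by simp
      then show ?thesis using 2 one fibbinary_1 fibbinary_4k1[of 1] by simp
    next
      case 3
      have "2 ^ Suc K + x = 4 * (2 ^ Suc L + y) + 1" using one 3 by simp
      then have "fibbinary (2 ^ Suc K + x) \<longleftrightarrow> fibbinary (2 ^ Suc L + y)"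
        by (simp only: fibbinary_4k1)
      moreover have "x < 2 ^ K \<longleftrightarrow> y < 2 ^ L" using one 3 by simp presburger
      ultimately show ?thesis
        using less.IH[of L y] less.prems one 3 fibbinary_4k1[of y] by simp
    qed
  next
    case three
    obtain L where L: "K = Suc L" using three less.prems by (cases K) auto
    have "2 ^ Suc K + x = 4 * (2 ^ L + y) + 3" using three L by simp
    \<comment> \<open>Both sides fail, because \<open>x\<close> itself also ends in 11.\<close>
    then show ?thesis using not_fibbinary_4k3 three by metis
  qed
qed

section \<open>Counting and enumerating fibbinary numbers\<close>

definition fibbinary_count :: "nat \<Rightarrow> nat" where
  "fibbinary_count x = card {m. m < x \<and> fibbinary m}"

text \<open>Past \<open>2 ^ Suc K\<close> the members are translates of those below
  \<open>2 ^ K\<close>; the minimum records that no further ones follow before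
  \<open>2 ^ (K + 2)\<close>. Taking \<open>x = 2 ^ Suc K\<close> yields the Fibonacci
  recurrence.\<close>

lemma fibbinary_count_power2_add:
  assumes "x \<le> 2 ^ Suc K"
  shows "fibbinary_count (2 ^ Suc K + x) = fibbinary_count (2 ^ Suc K) + fibbinary_count (min x (2 ^ K))"
proof -
  let ?N = "2 ^ Suc K :: nat"
  let ?A = "{m. m < ?N \<and> fibbinary m}" and ?B = "{m. m < min x (2 ^ K) \<and> fibbinary m}"
  have "{m. m < ?N + x \<and> fibbinary m} = ?A \<union> (+) ?N ` ?B"
  proof (intro set_eqI)
    fix m
    show "m \<in> {m. m < ?N + x \<and> fibbinary m} \<longleftrightarrow> m \<in> ?A \<union> (+) ?N ` ?B"
    proof (cases "m < ?N")
      case False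
      then obtain y where y: "m = ?N + y" using le_iff_add by (metis not_less)
      have "y < x \<and> fibbinary (?N + y) \<longleftrightarrow> y < min x (2 ^ K) \<and> fibbinary y"
        using fibbinary_power2_add[of y K] assms by auto
      then show ?thesis using y by auto
    qed auto
  qed
  then have "fibbinary_count (?N + x) = card (?A \<union> (+) ?N ` ?B)"
    by (simp only: fibbinary_count_def)
  also have "\<dots> = card ?A + card ((+) ?N ` ?B)"
    by (intro card_Un_disjoint) auto
  also have "card ((+) ?N ` ?B) = card ?B"
    by (intro card_image) auto
  finally show ?thesis by (simp only: fibbinary_count_def)
qed

lemma fibbinary_count_power2: "fibbinary_count (2 ^ K) = fib (K + 2)"
proof (induction K rule: fib.induct)
  case 1
  have "{m. m < 1 \<and> fibbinary m} = {0}" using fibbinary_0 by auto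
  then show ?case by (simp add: fibbinary_count_def numeral_eq_Suc)
next
  case 2
  have "{m. m < 2 \<and> fibbinary m} = {0, 1}" using fibbinary_0 fibbinary_1 by (auto simp: less_2_cases_iff)
  then show ?case by (simp add: fibbinary_count_def numeral_eq_Suc)
next
  case (3 K)
  then show ?case using fibbinary_count_power2_add[of "2 ^ Suc K" K] by (simp add: mult_2)
qed

definition nth_fibbinary :: "nat \<Rightarrow> nat" where
  "nth_fibbinary = enumerate {m. fibbinary m}"

lemma infinite_fibbinary: "infinite {m. fibbinary m}"
proof -
  have "inj (\<lambda>K. 2 ^ K :: nat)" by (auto intro: injI)
  then have "infinite (range (\<lambda>K. 2 ^ K :: nat))" by (rule range_inj_infinite)
  then show ?thesis
    by (rule infinite_super[rotated]) (auto simp: fibbinary_power2)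
qed

lemma strict_mono_nth_fibbinary: "strict_mono nth_fibbinary"
  unfolding nth_fibbinary_def by (intro strict_monoI enumerate_mono infinite_fibbinary)

lemma range_nth_fibbinary: "range nth_fibbinary = {m. fibbinary m}"
  unfolding nth_fibbinary_def using bij_enumerate[OF infinite_fibbinary] by (rule bij_betw_imp_surj_on)

text \<open>Makes counting inverse to the enumeration, so values of \<open>nth_fibbinary\<close> can
  be read off from counts.\<close>

lemma fibbinary_count_nth: "fibbinary_count (nth_fibbinary n) = n"
proof -
  have "{m. m < nth_fibbinary n \<and> fibbinary m} = nth_fibbinary ` {..<n}"
  proof (intro set_eqI iffI)
    fix m assume m: "m \<in> {m. m < nth_fibbinary n \<and> fibbinary m}"
    then have "m \<in> range nth_fibbinary" by (simp add: range_nth_fibbinary)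
    then show "m \<in> nth_fibbinary ` {..<n}"
      using m by (auto simp: strict_mono_less[OF strict_mono_nth_fibbinary])
  next
    fix m assume "m \<in> nth_fibbinary ` {..<n}"
    then show "m \<in> {m. m < nth_fibbinary n \<and> fibbinary m}"
      using range_nth_fibbinary by (auto simp: strict_mono_less[OF strict_mono_nth_fibbinary])
  qed
  then show ?thesis
    using strict_mono_imp_inj_on[OF strict_mono_nth_fibbinary]
    by (simp add: fibbinary_count_def card_image inj_on_subset)
qed

lemma nth_fibbinary_count: "fibbinary m \<Longrightarrow> nth_fibbinary (fibbinary_count m) = m"
  using range_nth_fibbinary fibbinary_count_nth by (metis mem_Collect_eq rangeE)

lemma fibbinary_nth: "fibbinary (nth_fibbinary n)"
  using range_nth_fibbinary by blast

lemma nth_fibbinary_0: "nth_fibbinary 0 = 0"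
  using nth_fibbinary_count[OF fibbinary_0] by (simp add: fibbinary_count_def)

lemma nth_fibbinary_fib: "nth_fibbinary (fib (K + 2)) = 2 ^ K"
  using nth_fibbinary_count[OF fibbinary_power2] fibbinary_count_power2 by metis

text \<open>Translation by \<open>2 ^ Suc K\<close> keeps members below \<open>2 ^ K\<close>
  fibbinary and raises their rank by the number of members below \<open>2 ^ Suc K\<close>.\<close>

lemma nth_fibbinary_fib_add:
  assumes "j < fib (K + 2)"
  shows "nth_fibbinary (fib (K + 3) + j) = 2 ^ Suc K + nth_fibbinary j"
proof -
  have less: "nth_fibbinary j < 2 ^ K"
    using assms strict_mono_nth_fibbinary nth_fibbinary_fib[of K] by (metis strict_monoD)
  then have "fibbinary (2 ^ Suc K + nth_fibbinary j)"
    using fibbinary_power2_add[of "nth_fibbinary j" K] fibbinary_nth by simp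
  moreover have "fibbinary_count (2 ^ Suc K + nth_fibbinary j) = fib (K + 3) + j"
    using fibbinary_count_power2_add[of "nth_fibbinary j" K] less fibbinary_count_power2[of "Suc K"]
    by (simp add: fibbinary_count_nth numeral_eq_Suc)
  ultimately show ?thesis using nth_fibbinary_count by metis
qed

section \<open>Zero runs as gaps between nonzero terms\<close>

text \<open>The runs are numbered from 1, so the \<open>Suc i\<close>-th one lies between \<open>e i\<close> and \<open>e (Suc i)\<close>.\<close>

lemma run_length_between_nonzeros:
  fixes e :: "nat \<Rightarrow> nat"
  assumes e: "strict_mono e" "e 0 = 0" "\<And>i. Suc (e i) < e (Suc i)"
    and range_e: "range e = {n. T_seq n mod p \<noteq> 0}"
  shows "run_length p (Suc i) = e (Suc i) - Suc (e i)"
proof -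
  let ?R = "\<lambda>i. {e i<..<e (Suc i)}"
  have nonzero: "T_seq (e i) mod p \<noteq> 0" for i
    using range_e by blast
  \<comment> \<open>An interval leaving the gap would contain one of its end points, where the
    sequence is nonzero.\<close>
  have sub: "J \<subseteq> ?R i" if J: "zero_interval p J" and n: "n \<in> J" "n \<in> ?R i" for J i n
  proof
    fix x assume x: "x \<in> J"
    have "e k \<notin> J" for k using J nonzero[of k] unfolding zero_interval_def by auto
    then show "x \<in> ?R i"
      using J n x unfolding zero_interval_def nat_interval_def
      by (metis greaterThanLessThan_iff less_imp_le not_le)
  qed
  have cover: "\<exists>i. e i \<le> n \<and> n < e (Suc i)" for n
  proof (induction n)
    case 0
    show ?case using e(2) e(3)[of 0] by (intro exI[of _ 0]) simp
  next
    case (Suc n)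
    then obtain i where i: "e i \<le> n" "n < e (Suc i)" by blast
    show ?case
    proof (cases "Suc n < e (Suc i)")
      case True
      then show ?thesis using i by (intro exI[of _ i]) simp
    next
      case False
      then have "Suc n = e (Suc i)" using i by simp
      then show ?thesis using e(3)[of "Suc i"] by (intro exI[of _ "Suc i"]) simp
    qed
  qed
  have zero: "zero_interval p (?R i)" for i
    unfolding zero_interval_def
  proof (intro conjI ballI)
    \<comment> \<open>Nonzero terms are at least two apart, so every gap contains a run.\<close>
    show "?R i \<noteq> {}" using e(3)[of i] by (metis empty_iff greaterThanLessThan_iff lessI)
    show "nat_interval (?R i)" unfolding nat_interval_def by auto
    fix n assume n: "n \<in> ?R i"
    have "n \<noteq> e j" for j
      using n strict_mono_less[OF e(1)] by (metis greaterThanLessThan_iff less_Suc_eq not_less_eq)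
    then show "T_seq n mod p = 0" using range_e by blast
  qed
  have run: "zero_run p I \<longleftrightarrow> (\<exists>i. I = ?R i)" for I
  proof
    assume I: "zero_run p I"
    then obtain n where n: "n \<in> I" unfolding zero_run_def zero_interval_def by blast
    obtain i where i: "e i \<le> n" "n < e (Suc i)" using cover by blast
    have "n \<noteq> e i" using I n nonzero[of i] unfolding zero_run_def zero_interval_def by auto
    then have "I \<subseteq> ?R i" using sub[of I n i] I n i unfolding zero_run_def by simp
    then show "\<exists>i. I = ?R i" using I zero unfolding zero_run_def by blast
  next
    assume "\<exists>i. I = ?R i"
    then obtain i where i: "I = ?R i" by blast
    have "J = I" if J: "zero_interval p J" "I \<subseteq> J" for J
    proof -
      obtain n where "n \<in> I" using zero[of i] i unfolding zero_interval_def by blast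
      then have "J \<subseteq> ?R i" using sub[of J n i] J i by blast
      then show ?thesis using J i by blast
    qed
    then show "zero_run p I" using zero i unfolding zero_run_def by blast
  qed
  have before: "(\<forall>m\<in>?R j. \<forall>n\<in>?R i. m < n) \<longleftrightarrow> j < i" for i j
  proof
    assume *: "\<forall>m\<in>?R j. \<forall>n\<in>?R i. m < n"
    have "Suc (e j) \<in> ?R j" "Suc (e i) \<in> ?R i" using e(3) by auto
    then have "e j < e i" using * by blast
    then show "j < i" by (simp add: strict_mono_less[OF e(1)])
  next
    assume "j < i"
    then have "e (Suc j) \<le> e i" by (simp add: strict_mono_less_eq[OF e(1)])
    then show "\<forall>m\<in>?R j. \<forall>n\<in>?R i. m < n" by auto
  qed
  have inj: "inj ?R"
  proof (rule injI)
    fix i j assume eq: "?R i = ?R j"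
    \<comment> \<open>Otherwise a nonempty gap would lie entirely to the left of itself.\<close>
    then have "\<not> i < j" "\<not> j < i" using before zero unfolding zero_interval_def
      by (metis equals0I less_irrefl)+
    then show "i = j" by simp
  qed
  have "{J. zero_run p J \<and> (\<forall>m\<in>J. \<forall>n\<in>?R i. m < n)} = ?R ` {..<i}" for i
  proof -
    have "{J. zero_run p J \<and> (\<forall>m\<in>J. \<forall>n\<in>?R i. m < n)} = ?R ` {j. \<forall>m\<in>?R j. \<forall>n\<in>?R i. m < n}"
      unfolding run by blast
    then show ?thesis by (simp only: before lessThan_def)
  qed
  then have card: "card {J. zero_run p J \<and> (\<forall>m\<in>J. \<forall>n\<in>?R i. m < n)} = i" for i
    using card_image[OF inj_on_subset[OF inj subset_UNIV]] by (simp only: card_lessThan)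
  then have nth: "nth_zero_run p (Suc i) (?R i)"
    unfolding nth_zero_run_def using run by auto
  have "I = ?R i" if "nth_zero_run p (Suc i) I" for I
  proof -
    have "zero_run p I" using that by (simp only: nth_zero_run_def)
    then obtain j where j: "I = ?R j" unfolding run ..
    then have "j = i" using that unfolding j nth_zero_run_def card by simp
    then show ?thesis using j by simp
  qed
  then have "(THE I. nth_zero_run p (Suc i) I) = ?R i"
    using nth by (rule the_equality[rotated])
  then show "run_length p (Suc i) = e (Suc i) - Suc (e i)"
    unfolding run_length_def by simp
qed

section \<open>Run lengths modulo 2 at and between Fibonacci indices\<close>

lemma run_length_2_Suc:
  "run_length 2 (Suc i) = 2 * nth_fibbinary (Suc i) - Suc (2 * nth_fibbinary i)"
proof (rule run_length_between_nonzeros[where e = "\<lambda>i. 2 * nth_fibbinary i"])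
  show "strict_mono (\<lambda>i. 2 * nth_fibbinary i)"
    using strict_mono_nth_fibbinary by (simp add: strict_mono_def)
  show "Suc (2 * nth_fibbinary i) < 2 * nth_fibbinary (Suc i)" for i
    using strict_monoD[OF strict_mono_nth_fibbinary, of i "Suc i"] by simp
  have "(\<lambda>i. 2 * nth_fibbinary i) ` UNIV = (*) 2 ` {m. fibbinary m}"
    using range_nth_fibbinary by (metis image_image)
  also have "\<dots> = {n. T_seq n mod 2 \<noteq> 0}"
    using odd_T_seq_iff by (auto simp: odd_iff_mod_2_eq_one)
  finally show "range (\<lambda>i. 2 * nth_fibbinary i) = {n. T_seq n mod 2 \<noteq> 0}" .
qed (simp add: nth_fibbinary_0)

lemma run_length_2_fib_add:
  assumes "0 < j" "j < fib (K + 2)"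
  shows "run_length 2 (fib (K + 3) + j) = run_length 2 j"
proof -
  obtain i where i: "j = Suc i" using assms gr0_implies_Suc by blast
  \<comment> \<open>Both ends of run \<open>j\<close>, given by the ranks \<open>i\<close> and
    \<open>j\<close>, are translated by the same amount.\<close>
  then show ?thesis
    using nth_fibbinary_fib_add[of j K] nth_fibbinary_fib_add[of i K] assms
    by (simp add: run_length_2_Suc)
qed

text \<open>Consecutive Jacobsthal numbers sum to a power of two. The resulting two-step recurrence
  is the one that the run lengths satisfy.\<close>

lemma jacobsthal_add2: "jacobsthal (n + 2) = 2 ^ n + jacobsthal n"
proof -
  have "jacobsthal n + jacobsthal (Suc n) = 2 ^ n"
    by (induction n) auto
  then show ?thesis by simp
qed

lemma run_length_2_fib: "run_length 2 (fib (K + 2)) = jacobsthal (K + 1)"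
proof (induction K rule: fib.induct)
  case 1
  show ?case using run_length_2_Suc[of 0] nth_fibbinary_0 nth_fibbinary_fib[of 0]
    by (simp add: numeral_eq_Suc)
next
  case 2
  show ?case using run_length_2_Suc[of 1] nth_fibbinary_fib[of 0] nth_fibbinary_fib[of 1]
    by (simp add: numeral_eq_Suc)
next
  case (3 K)
  have "0 < fib (K + 2)" by (simp add: fib_neq_0_nat)
  \<comment> \<open>Rank \<open>i\<close> belongs to the last fibbinary number below
    \<open>2 ^ K\<close>; its translate is the last one below \<open>2 ^ (K + 2)\<close>.\<close>
  then obtain i where i: "fib (K + 2) = Suc i" using gr0_implies_Suc by blast
  then have fib4: "fib (Suc (Suc K) + 2) = Suc (fib (K + 3) + i)"
    by (simp add: numeral_eq_Suc)
  have "nth_fibbinary (fib (K + 3) + i) = 2 ^ Suc K + nth_fibbinary i"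
    using nth_fibbinary_fib_add i by simp
  moreover have "nth_fibbinary (Suc (fib (K + 3) + i)) = 2 ^ Suc (Suc K)"
    using nth_fibbinary_fib[of "Suc (Suc K)"] fib4 by simp
  moreover have "nth_fibbinary (Suc i) = 2 ^ K"
    using nth_fibbinary_fib[of K] i by simp
  moreover have "nth_fibbinary i < nth_fibbinary (Suc i)"
    using strict_mono_nth_fibbinary by (simp add: strict_monoD)
  ultimately have "run_length 2 (fib (Suc (Suc K) + 2)) = 2 ^ Suc K + run_length 2 (fib (K + 2))"
    unfolding fib4 i run_length_2_Suc by simp
  then show ?case
    using 3 jacobsthal_add2[of "K + 1"] by simp
qed

section \<open>Bounds on run lengths and the records\<close>

text \<open>The increment is \<open>2 * jacobsthal n\<close>; at \<open>n = 0\<close> there is the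
  tie \<open>jacobsthal 1 = jacobsthal 2\<close>.\<close>

lemma jacobsthal_less_Suc: "0 < n \<Longrightarrow> jacobsthal (Suc n) < jacobsthal (Suc (Suc n))"
  by (induction n rule: jacobsthal.induct) auto

lemma jacobsthal_le_Suc: "jacobsthal n \<le> jacobsthal (Suc n)"
  by (cases n) auto

lemma fib_cases:
  assumes "0 < i"
  obtains K where "i = fib (K + 2)"
  | K j where "i = fib (K + 3) + j" "0 < j" "j < fib (K + 2)"
proof -
  have "\<exists>K. fib (K + 2) \<le> i \<and> i < fib (K + 3)"
    using assms
  proof (induction i rule: nat_induct_non_zero)
    case 1
    show ?case by (intro exI[of _ 0]) (simp add: numeral_eq_Suc)
  next
    case (Suc i)
    then obtain K where K: "fib (K + 2) \<le> i" "i < fib (K + 3)" by blast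
    show ?case
    proof (cases "Suc i < fib (K + 3)")
      case True
      then show ?thesis using K by (intro exI[of _ K]) simp
    next
      case False
      moreover have "0 < fib (K + 2)" by (simp add: fib_neq_0_nat)
      ultimately show ?thesis using K by (intro exI[of _ "Suc K"]) (simp add: numeral_eq_Suc)
    qed
  qed
  then obtain K where K: "fib (K + 2) \<le> i" "i < fib (K + 3)" by blast
  show ?thesis
  proof (cases "i = fib (K + 2)")
    case True
    then show ?thesis using that(1) by blast
  next
    case False
    \<comment> \<open>No integer lies strictly between \<open>fib 2 = 1\<close> and
      \<open>fib 3 = 2\<close>, so \<open>K\<close> is positive.\<close>
    then obtain L where "K = Suc L" using K by (cases K) (auto simp: numeral_eq_Suc)
    then show ?thesis
      using that(2)[of L "i - fib (L + 3)"] K False by (simp add: numeral_eq_Suc)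
  qed
qed

text \<open>A run at a Fibonacci index has known length; any other run copies an earlier one with
  index \<open>j < fib (L + 2)\<close>, to which the induction applies with \<open>L\<close> in
  place of \<open>K\<close>.\<close>

lemma run_length_2_le_jacobsthal:
  assumes "0 < i" "i \<le> fib (K + 2)"
  shows "run_length 2 i \<le> jacobsthal (K + 1)"
  using assms
proof (induction i arbitrary: K rule: less_induct)
  case (less i)
  have mono: "jacobsthal m \<le> jacobsthal n" if "m \<le> n" for m n
    using lift_Suc_mono_le[of jacobsthal, OF jacobsthal_le_Suc that] .
  from less.prems(1) show ?case
  proof (cases rule: fib_cases)
    case (1 L)
    show ?thesis
    proof (cases "L \<le> K")
      case True
      then show ?thesis using 1 run_length_2_fib mono[of "L + 1" "K + 1"] by simp
    next
      case False
      then have "fib (K + 2) \<le> fib (L + 2)" by (intro fib_mono) simp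
      then have "i = fib (K + 2)" using 1 less.prems by simp
      then show ?thesis using run_length_2_fib by simp
    qed
  next
    case (2 L j)
    have "fib (L + 3) < fib (K + 2)" using 2 less.prems by simp
    then have "\<not> K + 2 \<le> L + 3" using fib_mono[of "K + 2" "L + 3"] by linarith
    then have "run_length 2 i \<le> jacobsthal (L + 1)" "L \<le> K"
      using less.IH[of j L] 2 run_length_2_fib_add[of j L] fib_neq_0_nat[of "L + 3"] by simp_all
    then show ?thesis using mono[of "L + 1" "K + 1"] by linarith
  qed
qed

theorem theorem3p2:
  shows "(\<forall>i\<ge>1. left_to_right_max (run_length 2) i \<longleftrightarrow> (\<exists>k\<ge>2. i = fib k))
       \<and> (\<forall>k\<ge>2. run_length 2 (fib k) = jacobsthal (k - 1))"
proof (intro conjI allI impI)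
  fix k :: nat assume "2 \<le> k"
  then obtain K where "k = K + 2" by (metis add.commute le_Suc_ex)
  then show "run_length 2 (fib k) = jacobsthal (k - 1)"
    using run_length_2_fib[of K] by simp
next
  fix i :: nat assume i: "1 \<le> i"
  show "left_to_right_max (run_length 2) i \<longleftrightarrow> (\<exists>k\<ge>2. i = fib k)"
  proof
    assume "\<exists>k\<ge>2. i = fib k"
    then obtain K where "i = fib (K + 2)" by (metis add.commute le_Suc_ex)
    then show "left_to_right_max (run_length 2) i"
      unfolding left_to_right_max_def
      using run_length_2_le_jacobsthal[of _ K] run_length_2_fib[of K] by simp
  next
    assume max: "left_to_right_max (run_length 2) i"
    from i have "0 < i" by simp
    then show "\<exists>k\<ge>2. i = fib k"
    proof (cases rule: fib_cases)
      case (1 K)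
      then show ?thesis by (intro exI[of _ "K + 2"]) simp
    next
      case (2 K j)
      then have "0 < K" by (cases K) (auto simp: numeral_eq_Suc)
      \<comment> \<open>Run \<open>i\<close> copies run \<open>j\<close>, so it is strictly shorter
        than the earlier run at \<open>fib (K + 3)\<close>; strictness matters because ties count as
        records.\<close>
      have "run_length 2 i \<le> jacobsthal (K + 1)"
        using 2 run_length_2_fib_add[of j K] run_length_2_le_jacobsthal[of j K] by simp
      also have "\<dots> < jacobsthal (K + 2)"
        using jacobsthal_less_Suc[OF \<open>0 < K\<close>] by simp
      also have "\<dots> = run_length 2 (fib (K + 3))"
        using run_length_2_fib[of "K + 1"] by (simp add: numeral_eq_Suc)
      finally have "run_length 2 i < run_length 2 (fib (K + 3))" .
      moreover have "1 \<le> fib (K + 3)" "fib (K + 3) < i"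
        using 2 fib_neq_0_nat[of "K + 3"] by simp_all
      ultimately show ?thesis using max unfolding left_to_right_max_def by force
    qed
  qed
qed

end
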